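(* If $G$ is a finite simple graph with at least one edge, then there exists a minimum positive semidefinite zero forcing set $B$ for $G$ such that the first force of some forcing process starting from $B$ is a force $u\to w$ in which $w$ is the only white neighbor of $u$ in the whole graph $G$ (that is, the first force can be done without using the disconnect rule).
   Context: Positive semidefinite zero forcing on a graph $G$: an initial set $B$ of vertices is blue, the rest white. At each step, let $W_1,\dots,W_h$ be the vertex sets of the connected components of $G$ minus the current blue set; if a blue vertex $u$ has exactly one white neighbor $w$ in the subgraph induced by the blue vertices together with $W_i$ (for some $i$), then $u$ may force $w$, i.e. color $w$ blue. $B$ is a positive semidefinite zero forcing set if repeated application can make all vertices blue; it is minimum if it has minimum cardinality among such sets (this cardinality is $Z^+(G)$). *)

theory Defs
  imports "Graph_Theory.Digraph_Component"
begin

text \<open>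
  A finite simple graph is a \<^locale>\<open>graph\<close> of Graph\_Theory: a finite symmetric digraph without
  loops and parallel arcs, each edge being the pair of its two opposite arcs. Under symmetry the
  strongly connected components are the connected components of the underlying graph.
\<close>

definition white_neighbors :: "('a, 'b) pre_digraph \<Rightarrow> 'a set \<Rightarrow> 'a \<Rightarrow> 'a set" where
  "white_neighbors G S u = {x \<in> verts G. u \<rightarrow>\<^bsub>G\<^esub> x \<and> x \<notin> S}"

definition white_components :: "('a, 'b) pre_digraph \<Rightarrow> 'a set \<Rightarrow> 'a set set" where
  "white_components G S = pre_digraph.sccs_verts (G \<restriction> (verts G - S))"

definition psd_force :: "('a, 'b) pre_digraph \<Rightarrow> 'a set \<Rightarrow> 'a \<Rightarrow> 'a \<Rightarrow> bool" where
  "psd_force G S u w \<longleftrightarrow>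
     u \<in> S \<and> (\<exists>W \<in> white_components G S. white_neighbors (G \<restriction> (S \<union> W)) S u = {w})"

text \<open>
  A forcing process is the chronological list of its forces. Only complete processes, which end
  with every vertex blue, are admitted. The components are recomputed after every single force.
\<close>

fun psd_forcing_process :: "('a, 'b) pre_digraph \<Rightarrow> 'a set \<Rightarrow> ('a \<times> 'a) list \<Rightarrow> bool" where
  "psd_forcing_process G S [] \<longleftrightarrow> S = verts G"
| "psd_forcing_process G S ((u, w) # fs) \<longleftrightarrow>
     psd_force G S u w \<and> psd_forcing_process G (insert w S) fs"

definition psd_zero_forcing_set :: "('a, 'b) pre_digraph \<Rightarrow> 'a set \<Rightarrow> bool" where
  "psd_zero_forcing_set G B \<longleftrightarrow> B \<subseteq> verts G \<and> (\<exists>fs. psd_forcing_process G B fs)"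

definition minimum_psd_zero_forcing_set :: "('a, 'b) pre_digraph \<Rightarrow> 'a set \<Rightarrow> bool" where
  "minimum_psd_zero_forcing_set G B \<longleftrightarrow>
     psd_zero_forcing_set G B \<and> (\<forall>B'. psd_zero_forcing_set G B' \<longrightarrow> card B \<le> card B')"

end

theory Submission
  imports Defs
begin

text \<open>
  Let \<open>u\<close> force \<open>w\<close> in the component \<open>W\<close> as a first force from a minimum set \<open>B\<close>. Exchanging \<open>u\<close> for \<open>w\<close>
  gives another minimum set \<open>B'\<close>, as \<open>w\<close> can force \<open>u\<close> back. If \<open>W = {w}\<close>, then \<open>u\<close> is the only
  white neighbor of \<open>w\<close> relative to \<open>B'\<close>. Otherwise some later force enters \<open>W - {w}\<close>; it is not
  made by \<open>u\<close>, whose only neighbor in \<open>W\<close> is \<open>w\<close>, so it is also a possible first force from \<open>B'\<close>,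
  inside a component strictly smaller than \<open>W\<close>. Hence one concludes by induction on the size of \<open>W\<close>.
\<close>

text \<open>The white component of \<open>w\<close>, named by one of its vertices and given by
  reachability, so that it can be bounded by induction along paths. It is empty unless
  \<open>w\<close> is a white vertex.\<close>

definition white_comp :: "('a, 'b) pre_digraph \<Rightarrow> 'a set \<Rightarrow> 'a \<Rightarrow> 'a set" where
  "white_comp G S w = {x. w \<rightarrow>\<^sup>*\<^bsub>G \<restriction> (verts G - S)\<^esub> x}"

lemma dominates_induce_subgraph_iff:
  "u \<rightarrow>\<^bsub>G \<restriction> A\<^esub> v \<longleftrightarrow> u \<rightarrow>\<^bsub>G\<^esub> v \<and> u \<in> A \<and> v \<in> A"
  by (auto simp: arcs_ends_conv)

section \<open>White components and forces in terms of reachability\<close>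

context graph
begin

lemma dominates_sym: "u \<rightarrow>\<^bsub>G\<^esub> v \<Longrightarrow> v \<rightarrow>\<^bsub>G\<^esub> u"
  using arcs_ends_symmetric[OF sym_arcs] by blast

lemma not_dominates_self: "\<not> u \<rightarrow>\<^bsub>G\<^esub> u"
  using no_loops by (auto simp: arcs_ends_conv)

lemma white_comp_subset: "white_comp G S w \<subseteq> verts G - S"
proof -
  interpret H: wf_digraph "G \<restriction> (verts G - S)" by auto
  show ?thesis unfolding white_comp_def using H.reachable_in_verts(2) by fastforce
qed

lemma white_comp_self: "w \<in> verts G - S \<Longrightarrow> w \<in> white_comp G S w"
  by (simp add: white_comp_def reachable_def)

lemma white_comp_step:
  assumes "x \<in> white_comp G S w" "x \<rightarrow>\<^bsub>G\<^esub> y" "y \<in> verts G - S"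
  shows "y \<in> white_comp G S w"
proof -
  interpret H: wf_digraph "G \<restriction> (verts G - S)" by auto
  have "x \<in> verts G - S" using assms(1) white_comp_subset by blast
  then show ?thesis
    using assms unfolding white_comp_def
    by (auto intro: H.reachable_adj_trans simp: dominates_induce_subgraph_iff)
qed

text \<open>Induction along a path from \<open>w\<close>. Later bounds on components after a change
  of the blue set all come from exhibiting a suitable closed set \<open>C\<close>.\<close>

lemma white_comp_least:
  assumes "w \<in> C"
    and closed: "\<And>x y. \<lbrakk>x \<in> C; x \<rightarrow>\<^bsub>G\<^esub> y; y \<in> verts G - S\<rbrakk> \<Longrightarrow> y \<in> C"
  shows "white_comp G S w \<subseteq> C"
proof
  interpret H: wf_digraph "G \<restriction> (verts G - S)" by auto
  fix x assume "x \<in> white_comp G S w"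
  then have "w \<rightarrow>\<^sup>*\<^bsub>G \<restriction> (verts G - S)\<^esub> x" by (simp add: white_comp_def)
  then show "x \<in> C"
  proof (induction rule: H.reachable_induct)
    case base
    show ?case by fact
  next
    case (step x y)
    then show ?case using closed by (simp add: dominates_induce_subgraph_iff)
  qed
qed

lemma white_components_eq: "white_components G S = white_comp G S ` (verts G - S)"
proof -
  interpret H: wf_digraph "G \<restriction> (verts G - S)" by auto
  have "symmetric (G \<restriction> (verts G - S))"
    by (rule induced_graph_imp_symmetric[OF sym_arcs]) auto
  then have "H.scc_of w = white_comp G S w" for w
    unfolding H.scc_of_def white_comp_def by (auto intro: symmetric_reachable)
  then show ?thesis
    by (simp add: white_components_def H.sccs_verts_conv_scc_of)
qed

lemma white_comp_eq:
  assumes "x \<in> white_comp G S w"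
  shows "white_comp G S x = white_comp G S w"
proof -
  interpret H: wf_digraph "G \<restriction> (verts G - S)" by auto
  have sym: "symmetric (G \<restriction> (verts G - S))"
    by (rule induced_graph_imp_symmetric[OF sym_arcs]) auto
  have wx: "w \<rightarrow>\<^sup>*\<^bsub>G \<restriction> (verts G - S)\<^esub> x" using assms by (simp add: white_comp_def)
  show ?thesis
    unfolding white_comp_def
    using H.reachable_trans[OF wx] H.reachable_trans[OF symmetric_reachable[OF sym wx]] by auto
qed

text \<open>The component witnessing a force contains the forced vertex \<open>w\<close>, so it can
  only be the component of \<open>w\<close>, and the quantifier over components disappears.\<close>

lemma psd_force_iff:
  "psd_force G S u w \<longleftrightarrow>
     u \<in> S \<and> w \<in> verts G - S \<and> u \<rightarrow>\<^bsub>G\<^esub> w \<and> (\<forall>x \<in> white_comp G S w. u \<rightarrow>\<^bsub>G\<^esub> x \<longrightarrow> x = w)"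
proof -
  have *: "white_neighbors (G \<restriction> (S \<union> white_comp G S v)) S u = {x \<in> white_comp G S v. u \<rightarrow>\<^bsub>G\<^esub> x}"
    if "u \<in> S" for v
    using that white_comp_subset[of S v]
    by (auto simp: white_neighbors_def dominates_induce_subgraph_iff)
  show ?thesis (is "?L \<longleftrightarrow> ?R")
  proof
    assume ?L
    then obtain v where "u \<in> S" "{x \<in> white_comp G S v. u \<rightarrow>\<^bsub>G\<^esub> x} = {w}"
      using * by (auto simp: psd_force_def white_components_eq)
    moreover from this have "w \<in> white_comp G S v" by blast
    ultimately show ?R using white_comp_eq[of w S v] white_comp_subset[of S v] by blast
  next
    assume ?R
    then have "{x \<in> white_comp G S w. u \<rightarrow>\<^bsub>G\<^esub> x} = {w}" using white_comp_self by blast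
    with \<open>?R\<close> * show ?L by (auto simp: psd_force_def white_components_eq)
  qed
qed

section \<open>Comparing forces for different blue sets\<close>

lemma psd_force_transfer:
  assumes "psd_force G S u w" "u \<in> T" "w \<notin> T" "white_comp G T w \<subseteq> white_comp G S w"
  shows "psd_force G T u w"
  using assms by (auto simp: psd_force_iff)

text \<open>Replay the process from the larger set and skip forces of vertices that are already
  blue. The other forces remain valid, since extra blue vertices only shrink the white
  components.\<close>

lemma psd_forcing_process_mono:
  assumes "psd_forcing_process G S fs" "S \<subseteq> T" "T \<subseteq> verts G"
  shows "\<exists>gs. psd_forcing_process G T gs"
  using assms
proof (induction fs arbitrary: S T)
  case Nil
  then show ?case by (intro exI[of _ "[]"]) auto
next
  case (Cons f fs)
  obtain u w where f: "f = (u, w)" by force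
  with Cons.prems have force: "psd_force G S u w" and rest: "psd_forcing_process G (insert w S) fs"
    by auto
  show ?case
  proof (cases "w \<in> T")
    case True
    then show ?thesis using Cons.IH[OF rest] Cons.prems by auto
  next
    case False
    with force Cons.prems have w: "w \<in> verts G - T" by (auto simp: psd_force_iff)
    have "white_comp G T w \<subseteq> white_comp G S w"
    proof (rule white_comp_least)
      show "w \<in> white_comp G S w" using w Cons.prems by (auto intro: white_comp_self)
    qed (use Cons.prems in \<open>auto intro: white_comp_step\<close>)
    then have "psd_force G T u w"
      using psd_force_transfer[OF force] force False Cons.prems by (auto simp: psd_force_iff)
    moreover obtain gs where "psd_forcing_process G (insert w T) gs"
      using Cons.IH[OF rest, of "insert w T"] w Cons.prems by auto
    ultimately have "psd_forcing_process G T ((u, w) # gs)" by simp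
    then show ?thesis by blast
  qed
qed

text \<open>\<open>C\<close> is a union of white components. The first force of the process that
  enters \<open>C\<close> can be made at once: the earlier forces color vertices outside
  \<open>C\<close>, which are not adjacent to \<open>C\<close> and so affect neither its components
  nor the choice of a forcing vertex.\<close>

lemma psd_force_into_closed_set:
  assumes "psd_forcing_process G S fs" "C \<noteq> {}" "C \<subseteq> verts G - S"
    and "\<And>x y. \<lbrakk>x \<in> C; x \<rightarrow>\<^bsub>G\<^esub> y; y \<in> verts G - S\<rbrakk> \<Longrightarrow> y \<in> C"
  shows "\<exists>u. \<exists>w \<in> C. psd_force G S u w"
  using assms
proof (induction fs arbitrary: S)
  case Nil
  then show ?case by auto
next
  case (Cons f fs)
  note closed = Cons.prems(4)
  obtain u w where f: "f = (u, w)" by force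
  with Cons.prems have force: "psd_force G S u w" and rest: "psd_forcing_process G (insert w S) fs"
    by auto
  show ?case
  proof (cases "w \<in> C")
    case True
    with force show ?thesis by blast
  next
    case False
    have "\<exists>u. \<exists>w' \<in> C. psd_force G (insert w S) u w'"
      by (rule Cons.IH[OF rest]) (use False Cons.prems in auto)
    then obtain u' w' where w': "w' \<in> C" and force': "psd_force G (insert w S) u' w'" by blast
    have w'S: "w' \<in> verts G - S" using w' Cons.prems by blast
    \<comment> \<open>Otherwise the vertex \<open>w\<close>, white for \<open>S\<close>, would be
      adjacent to \<open>w'\<close> and hence lie in \<open>C\<close>.\<close>
    have "u' \<noteq> w"
      using closed[OF w'] False force force' dominates_sym by (auto simp: psd_force_iff)
    have "white_comp G S w' \<subseteq> C \<inter> white_comp G (insert w S) w'"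
    proof (rule white_comp_least)
      show "w' \<in> C \<inter> white_comp G (insert w S) w'"
        using w' w'S False by (auto intro: white_comp_self)
      show "y \<in> C \<inter> white_comp G (insert w S) w'"
        if "x \<in> C \<inter> white_comp G (insert w S) w'" "x \<rightarrow>\<^bsub>G\<^esub> y" "y \<in> verts G - S" for x y
      proof -
        have "y \<in> C" using closed that by blast
        with that False show ?thesis by (auto intro: white_comp_step)
      qed
    qed
    then have "psd_force G S u' w'"
      using psd_force_transfer[OF force'] force' w'S \<open>u' \<noteq> w\<close> by (auto simp: psd_force_iff)
    with w' show ?thesis by blast
  qed
qed

section \<open>Exchanging the two ends of a first force\<close>

lemma psd_force_exchange:
  assumes force: "psd_force G B u w"
  shows "psd_force G (insert w (B - {u})) w u"
    and "white_neighbors G (insert w (B - {u})) w \<subseteq> insert u (white_comp G B w - {w})"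
proof -
  let ?B' = "insert w (B - {u})" and ?W = "white_comp G B w"
  have uw: "u \<in> B" "w \<in> verts G - B" "u \<rightarrow>\<^bsub>G\<^esub> w" and uniq: "\<And>x. \<lbrakk>x \<in> ?W; u \<rightarrow>\<^bsub>G\<^esub> x\<rbrakk> \<Longrightarrow> x = w"
    using force by (auto simp: psd_force_iff)
  have w: "w \<in> ?W" using uw by (auto intro: white_comp_self)
  have u: "u \<in> verts G - ?B'" using uw adj_in_verts by auto
  have nbr: "x \<in> insert u (?W - {w})" if "w \<rightarrow>\<^bsub>G\<^esub> x" "x \<in> verts G - ?B'" for x
    using that white_comp_step[OF w] by auto
  then show "white_neighbors G ?B' w \<subseteq> insert u (?W - {w})"
    by (auto simp: white_neighbors_def)
  \<comment> \<open>The new component of \<open>u\<close> avoids \<open>?W\<close>: the only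
    neighbor of \<open>u\<close> in \<open>?W\<close> is \<open>w\<close>, which is now blue, and no
    other white vertex outside \<open>?W\<close> is adjacent to \<open>?W\<close>. By
    \<open>nbr\<close>, \<open>w\<close> then sees only \<open>u\<close> in that component.\<close>
  have "white_comp G ?B' u \<subseteq> verts G - ?B' - ?W"
  proof (rule white_comp_least)
    show "u \<in> verts G - ?B' - ?W" using u uw white_comp_subset by blast
    show "y \<in> verts G - ?B' - ?W"
      if x: "x \<in> verts G - ?B' - ?W" and xy: "x \<rightarrow>\<^bsub>G\<^esub> y" and y: "y \<in> verts G - ?B'" for x y
    proof -
      have "y \<notin> ?W"
      proof
        assume yW: "y \<in> ?W"
        then have "x \<noteq> u" using uniq[of y] xy y by blast
        then have "x \<in> verts G - B" using x by blast
        then show False using white_comp_step[OF yW] xy x dominates_sym by blast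
      qed
      with y show ?thesis by blast
    qed
  qed
  then show "psd_force G ?B' w u"
    using nbr u uw dominates_sym white_comp_subset[of ?B' u] unfolding psd_force_iff by blast
qed

text \<open>After \<open>w\<close> forces \<open>u\<close> back, the blue set is
  \<open>insert w B\<close>, which contains \<open>B\<close>; monotonicity completes the process.
  The exchange preserves cardinality.\<close>

lemma minimum_psd_zero_forcing_set_exchange:
  assumes min: "minimum_psd_zero_forcing_set G B" and force: "psd_force G B u w"
  shows "minimum_psd_zero_forcing_set G (insert w (B - {u}))"
    and "\<exists>fs. psd_forcing_process G (insert w (B - {u})) ((w, u) # fs)"
proof -
  let ?B' = "insert w (B - {u})"
  have uw: "u \<in> B" "w \<in> verts G - B" using force by (auto simp: psd_force_iff)
  obtain fs where fs: "psd_forcing_process G B fs" and B: "B \<subseteq> verts G"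
    using min by (auto simp: minimum_psd_zero_forcing_set_def psd_zero_forcing_set_def)
  have ins: "insert u ?B' = insert w B" using uw by auto
  obtain gs where "psd_forcing_process G (insert u ?B') gs"
    using psd_forcing_process_mono[OF fs, of "insert w B"] uw B unfolding ins by blast
  then have "psd_forcing_process G ?B' ((w, u) # gs)"
    using psd_force_exchange(1)[OF force] by simp
  then show "\<exists>fs. psd_forcing_process G ?B' ((w, u) # fs)" by blast
  then have "psd_zero_forcing_set G ?B'"
    using B uw unfolding psd_zero_forcing_set_def by blast
  moreover have "card ?B' = card B"
    using uw finite_subset[OF B] card_Suc_Diff1[of B u] by simp
  ultimately show "minimum_psd_zero_forcing_set G ?B'"
    using min by (simp add: minimum_psd_zero_forcing_set_def)
qed

text \<open>Once \<open>w\<close> is added to \<open>B\<close>, the rest of its component is a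
  nonempty closed set, so some force enters it immediately. That force survives making
  \<open>u\<close> white, because \<open>u\<close> has no neighbor in this set.\<close>

lemma psd_force_smaller_component:
  assumes zf: "psd_zero_forcing_set G B" and force: "psd_force G B u w"
    and ne: "white_comp G B w \<noteq> {w}"
  obtains u' w' where "psd_force G (insert w (B - {u})) u' w'"
    "white_comp G (insert w (B - {u})) w' \<subset> white_comp G B w"
proof -
  let ?B' = "insert w (B - {u})" and ?T = "insert w B" and ?W = "white_comp G B w"
  have uw: "u \<in> B" "w \<in> verts G - B" "u \<rightarrow>\<^bsub>G\<^esub> w" and uniq: "\<And>x. \<lbrakk>x \<in> ?W; u \<rightarrow>\<^bsub>G\<^esub> x\<rbrakk> \<Longrightarrow> x = w"
    using force by (auto simp: psd_force_iff)
  have w: "w \<in> ?W" using uw by (auto intro: white_comp_self)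
  obtain fs where fs: "psd_forcing_process G B fs" and B: "B \<subseteq> verts G"
    using zf by (auto simp: psd_zero_forcing_set_def)
  obtain gs where gs: "psd_forcing_process G ?T gs"
    using psd_forcing_process_mono[OF fs, of ?T] uw B by blast
  have closed: "y \<in> ?W - {w}" if "x \<in> ?W - {w}" "x \<rightarrow>\<^bsub>G\<^esub> y" "y \<in> verts G - ?T" for x y
    using that white_comp_step by blast
  have "?W - {w} \<noteq> {}" "?W - {w} \<subseteq> verts G - ?T"
    using ne w white_comp_subset[of B w] by auto
  then have "\<exists>u'. \<exists>w' \<in> ?W - {w}. psd_force G ?T u' w'"
    by (rule psd_force_into_closed_set[OF gs]) (rule closed)
  then obtain u' w' where w': "w' \<in> ?W - {w}" and force': "psd_force G ?T u' w'"
    by blast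
  have w'T: "w' \<in> verts G - ?T" using w' white_comp_subset[of B w] by blast
  have "u' \<noteq> u" using uniq w' force' by (auto simp: psd_force_iff)
  have comp: "white_comp G ?B' w' \<subseteq> (?W - {w}) \<inter> white_comp G ?T w'"
  proof (rule white_comp_least)
    show "w' \<in> (?W - {w}) \<inter> white_comp G ?T w'"
      using w' white_comp_self[OF w'T] by blast
    show "y \<in> (?W - {w}) \<inter> white_comp G ?T w'"
      if x: "x \<in> (?W - {w}) \<inter> white_comp G ?T w'" and xy: "x \<rightarrow>\<^bsub>G\<^esub> y" and y: "y \<in> verts G - ?B'"
      for x y
    proof -
      \<comment> \<open>\<open>u\<close> is the only vertex white for \<open>?B'\<close> but blue
        for \<open>?T\<close>; excluding it reduces the claim to closedness relative to
        \<open>?T\<close>.\<close>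
      have "y \<noteq> u" using uniq[of x] x xy dominates_sym by blast
      then have "y \<in> verts G - ?T" using y by blast
      then show ?thesis using closed[of x y] white_comp_step x xy by blast
    qed
  qed
  have "psd_force G ?B' u' w'"
    using psd_force_transfer[OF force'] comp force' w'T \<open>u' \<noteq> u\<close> by (auto simp: psd_force_iff)
  moreover have "white_comp G ?B' w' \<subset> ?W" using comp w by blast
  ultimately show thesis by (rule that)
qed

lemma minimum_psd_force_without_disconnect:
  assumes "minimum_psd_zero_forcing_set G B" "psd_force G B u w"
  shows "\<exists>B. minimum_psd_zero_forcing_set G B \<and>
           (\<exists>u w fs. psd_forcing_process G B ((u, w) # fs) \<and> white_neighbors G B u = {w})"
  using assms
proof (induction "card (white_comp G B w)" arbitrary: B u w rule: less_induct)
  case less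
  let ?B' = "insert w (B - {u})"
  note exch = minimum_psd_zero_forcing_set_exchange[OF less.prems]
  show ?case
  proof (cases "white_comp G B w = {w}")
    case True
    have "u \<in> white_neighbors G ?B' w"
      using less.prems(2) adj_in_verts dominates_sym
      by (auto simp: white_neighbors_def psd_force_iff)
    \<comment> \<open>With no other vertex in the component, the exchange leaves \<open>u\<close> as
      the only possible white neighbor of \<open>w\<close> in all of \<open>G\<close>.\<close>
    then have "white_neighbors G ?B' w = {u}"
      using psd_force_exchange(2)[OF less.prems(2)] True by auto
    with exch show ?thesis by blast
  next
    case False
    have "psd_zero_forcing_set G B"
      using less.prems by (simp add: minimum_psd_zero_forcing_set_def)
    from psd_force_smaller_component[OF this less.prems(2) False]
    obtain u' w' where force': "psd_force G ?B' u' w'"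
      and sub: "white_comp G ?B' w' \<subset> white_comp G B w" .
    have "finite (white_comp G B w)"
      using white_comp_subset finite_verts by (meson finite_Diff finite_subset)
    then have "card (white_comp G ?B' w') < card (white_comp G B w)"
      using sub by (rule psubset_card_mono)
    then show ?thesis using less.hyps exch(1) force' by blast
  qed
qed

text \<open>The only white component is \<open>{w}\<close>, so \<open>u\<close> forces
  \<open>w\<close>. This provides a zero forcing set smaller than the whole vertex set.\<close>

lemma psd_zero_forcing_set_remove_vertex:
  assumes "u \<rightarrow>\<^bsub>G\<^esub> w"
  shows "psd_zero_forcing_set G (verts G - {w})"
proof -
  have uw: "u \<in> verts G" "w \<in> verts G" "u \<noteq> w"
    using assms adj_in_verts not_dominates_self by auto
  have "psd_force G (verts G - {w}) u w"
    using assms uw white_comp_subset[of "verts G - {w}" w] by (auto simp: psd_force_iff)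
  then have "psd_forcing_process G (verts G - {w}) [(u, w)]"
    using uw by (simp add: insert_absorb)
  then show ?thesis unfolding psd_zero_forcing_set_def by blast
qed

end

theorem theorem2p31:
  fixes G :: "('a, 'b) pre_digraph"
  assumes "graph G"
    and "arcs G \<noteq> {}"
  shows "\<exists>B. minimum_psd_zero_forcing_set G B \<and>
           (\<exists>u w fs. psd_forcing_process G B ((u, w) # fs) \<and> white_neighbors G B u = {w})"
proof -
  interpret graph G by fact
  obtain u w where edge: "u \<rightarrow>\<^bsub>G\<^esub> w" using assms(2) in_arcs_imp_in_arcs_ends by blast
  note zf = psd_zero_forcing_set_remove_vertex[OF edge]
  obtain B where B: "minimum_psd_zero_forcing_set G B"
    using ex_has_least_nat[of "psd_zero_forcing_set G" _ card, OF zf]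
    by (auto simp: minimum_psd_zero_forcing_set_def)
  then obtain fs where fs: "psd_forcing_process G B fs"
    by (auto simp: minimum_psd_zero_forcing_set_def psd_zero_forcing_set_def)
  \<comment> \<open>A minimum set is therefore not all of \<open>verts G\<close>, and its process
    must contain a first force.\<close>
  have "card B \<le> card (verts G - {w})"
    using B zf by (simp add: minimum_psd_zero_forcing_set_def)
  also have "\<dots> < card (verts G)"
    using edge adj_in_verts(2) by (intro card_Diff1_less) auto
  finally have "fs \<noteq> []" using fs by auto
  then obtain x y gs where "fs = (x, y) # gs" by (cases fs) auto
  then have "psd_force G B x y" using fs by simp
  with B show ?thesis by (rule minimum_psd_force_without_disconnect)
qed

end
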